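(* Let $p$ be a prime with $p\equiv 7\pmod 8$, let $C$ be the quasi-quadratic residue code associated with $p$, and let $\mathcal{Q}$ and $\mathcal{N}$ be the quadratic residue codes associated with $p$. Then $C$ is the even subcode of $\mathcal{Q}\oplus\mathcal{N}$ (the subcode of all codewords of even weight). Moreover, the minimum distances satisfy $d(C)=d(\mathcal{Q})+1$.
   Context: Let $Q\subset\mathbb{F}_p$ be the set of (nonzero) quadratic residues and $N$ the set of quadratic non-residues. For $S\subseteq\mathbb{F}_p$ put $r_S=\sum_{a\in S}x^a\in\mathbb{F}_2[x]/(x^p-1)$; elements of this ring are identified with vectors of $\mathbb{F}_2^p$ via their coefficients. The quadratic residue codes associated with $p$ are $\mathcal{Q}=\{r_Qr_S : S\subseteq\mathbb{F}_p\}$ and $\mathcal{N}=\{r_Nr_S : S\subseteq\mathbb{F}_p\}$, binary linear codes of length $p$. The quasi-quadratic residue code associated with $p$ is $C=\{(r_Qr_S,\,r_Nr_S):S\subseteq\mathbb{F}_p\}\subseteq\mathbb{F}_2^{2p}$. The direct sum is $\mathcal{Q}\oplus\mathcal{N}=\{(u,v):u\in\mathcal{Q},v\in\mathcal{N}\}\subseteq\mathbb{F}_2^{2p}$. $d(\cdot)$ denotes the minimum distance, i.e. the minimum nonzero weight of a linear code. *)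

theory Defs
  imports
    "HOL-Library.Z2"
    "HOL-Computational_Algebra.Polynomial"
    "HOL-Number_Theory.Number_Theory"
    "Jordan_Normal_Form.Matrix"
begin

(* The field F_p is represented by its residue system {..<p} of natural numbers, which
   are also the exponents of x.  The field F_2 is the library type bit.
   QuadRes alone counts 0 as a square, so 0 is excluded explicitly below. *)

definition quad_residues :: "nat \<Rightarrow> nat set" where
  "quad_residues p = {a \<in> {..<p}. a \<noteq> 0 \<and> QuadRes (int p) (int a)}"

definition quad_nonresidues :: "nat \<Rightarrow> nat set" where
  "quad_nonresidues p = {a \<in> {..<p}. \<not> QuadRes (int p) (int a)}"

definition set_poly :: "nat set \<Rightarrow> bit poly" where
  "set_poly S = (\<Sum>a\<in>S. Polynomial.monom 1 a)"

(* Elements of F_2[x]/(x^p - 1) are represented by their unique representatives of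
   degree less than p. *)

definition cyclic_mult :: "nat \<Rightarrow> bit poly \<Rightarrow> bit poly \<Rightarrow> bit poly" where
  "cyclic_mult p f g = (f * g) mod (Polynomial.monom 1 p - 1)"

definition coeff_vec :: "nat \<Rightarrow> bit poly \<Rightarrow> bit vec" where
  "coeff_vec p f = vec p (Polynomial.coeff f)"

definition qr_code_Q :: "nat \<Rightarrow> bit vec set" where
  "qr_code_Q p =
     {coeff_vec p (cyclic_mult p (set_poly (quad_residues p)) (set_poly S)) | S. S \<subseteq> {..<p}}"

definition qr_code_N :: "nat \<Rightarrow> bit vec set" where
  "qr_code_N p =
     {coeff_vec p (cyclic_mult p (set_poly (quad_nonresidues p)) (set_poly S)) | S. S \<subseteq> {..<p}}"

(* Pairs (u, v) in F_2^p x F_2^p are identified with vectors of length 2p by concatenation. *)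

definition quasi_qr_code :: "nat \<Rightarrow> bit vec set" where
  "quasi_qr_code p =
     {coeff_vec p (cyclic_mult p (set_poly (quad_residues p)) (set_poly S)) @\<^sub>v
      coeff_vec p (cyclic_mult p (set_poly (quad_nonresidues p)) (set_poly S)) | S. S \<subseteq> {..<p}}"

definition code_direct_sum :: "bit vec set \<Rightarrow> bit vec set \<Rightarrow> bit vec set" where
  "code_direct_sum A B = {u @\<^sub>v v | u v. u \<in> A \<and> v \<in> B}"

definition hamming_weight :: "bit vec \<Rightarrow> nat" where
  "hamming_weight v = card {i. i < dim_vec v \<and> v $ i \<noteq> 0}"

definition even_subcode :: "bit vec set \<Rightarrow> bit vec set" where
  "even_subcode A = {c \<in> A. even (hamming_weight c)}"

(* For linear codes only; meaningful when the code is finite and has a nonzero word. *)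

definition min_distance :: "bit vec set \<Rightarrow> nat" where
  "min_distance A = Min (hamming_weight ` A - {0})"

end

(* Let rQ and rN be the polynomials of the residues and of the nonresidues, and J the all-ones
   polynomial.  Since 2 is a residue, squaring shows that rQ is idempotent; with 1 + rQ + rN = J
   this gives that rN is idempotent and rQ * rN = J modulo x^p - 1.  Hence a pair (rQ * f, rN * g)
   has the form (rQ * s, rN * s) as soon as f and g, equivalently the two components, have the
   same parity.

   For the minimum distance, extend the residue code by a parity coordinate at infinity.  The
   extended code is invariant under the translations y -> y + k and, by Gleason and Prange, under
   y -> -1/y, so any coordinate can be moved to infinity.  Moving a nonzero coordinate there turns
   a nonzero even word of weight w into one of weight w - 1, so the minimum weight d of the residue
   code is odd; moving a zero coordinate there turns an odd word of weight d into an even one of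
   weight d + 1.  Padded with the zero word, the latter lies in the quasi-quadratic residue code.
   Conversely, a nonzero word of that code has even weight and a nonzero component of weight at
   least d, because y -> -y identifies the two residue codes; its weight is thus at least d + 1. *)

theory Submission
  imports Defs
begin

section \<open>Quadratic residues modulo \<open>p = 7 (mod 8)\<close>\<close>

lemma Legendre_in: "Legendre a p \<in> {-1, 0, 1}"
  by (auto simp: Legendre_def)

text \<open>Two values in {-1, 0, 1} differ by at most 2, hence by less than p, so congruence forces
  equality.\<close>

lemma Legendre_eqI:
  fixes p :: nat and x y :: int
  assumes "2 < p" "[x = y] (mod int p)" "x \<in> {-1, 0, 1}" "y \<in> {-1, 0, 1}"
  shows "x = y"
proof -
  have "int p dvd x - y"
    using assms(2) by (simp add: cong_iff_dvd_diff)
  moreover have "\<bar>x - y\<bar> < int p"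
    using assms by auto
  ultimately show ?thesis
    using dvd_imp_le_int[of "x - y" "int p"] by fastforce
qed

text \<open>By Euler's criterion both sides are congruent to the power of \<open>a * b\<close> with
  exponent (p - 1)/2.\<close>

lemma Legendre_mult:
  fixes p :: nat
  assumes "prime p" "2 < p"
  shows "Legendre (a * b) p = Legendre a p * Legendre b p"
proof (rule Legendre_eqI[OF \<open>2 < p\<close>])
  note ec = euler_criterion[OF assms]
  have "[Legendre a p * Legendre b p = a ^ ((p - 1) div 2) * b ^ ((p - 1) div 2)] (mod p)"
    by (intro cong_mult ec)
  then show "[Legendre (a * b) p = Legendre a p * Legendre b p] (mod p)"
    using ec[of "a * b"] by (metis cong_sym cong_trans power_mult_distrib)
  show "Legendre (a * b) p \<in> {-1, 0, 1}" "Legendre a p * Legendre b p \<in> {-1, 0, 1}"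
    using Legendre_in[of a p] Legendre_in[of b p] Legendre_in[of "a * b" p] by auto
qed

locale qr_prime =
  fixes p :: nat
  assumes prime: "prime p" and mod8: "[p = 7] (mod 8)"
begin

lemma p_mod_8: "p mod 8 = 7"
  using mod8 by (simp add: cong_def)

lemma p_ge_7: "p \<ge> 7"
  using p_mod_8 by presburger

text \<open>Defined on all integers, so that differences such as \<open>y - a\<close> need no
  reduction modulo p.\<close>

definition qres :: "int \<Rightarrow> bool" where
  "qres z \<longleftrightarrow> \<not> int p dvd z \<and> QuadRes (int p) z"

lemma qres_iff_Legendre: "qres z \<longleftrightarrow> Legendre z p = 1"
  by (auto simp: qres_def Legendre_def cong_0_iff)

lemma Legendre_unit: "\<not> int p dvd z \<Longrightarrow> Legendre z p = (if qres z then 1 else -1)"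
  by (auto simp: qres_def Legendre_def cong_0_iff)

lemma not_qres_0: "int p dvd z \<Longrightarrow> \<not> qres z"
  by (simp add: qres_def)

lemma prime_int_p: "prime (int p)"
  using prime by simp

lemma qres_mult:
  assumes "\<not> int p dvd y" "\<not> int p dvd z"
  shows "qres (y * z) \<longleftrightarrow> (qres y \<longleftrightarrow> qres z)"
proof -
  have "\<not> int p dvd y * z"
    using assms prime_int_p by (simp add: prime_dvd_mult_iff)
  then show ?thesis
    using Legendre_mult[OF prime, of y z] p_ge_7 assms by (auto simp: Legendre_unit split: if_splits)
qed

lemma qres_cong:
  assumes "[y = z] (mod int p)"
  shows "qres y \<longleftrightarrow> qres z"
proof -
  have "int p dvd y \<longleftrightarrow> int p dvd z"
    using assms by (rule cong_dvd_iff)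
  moreover have "QuadRes (int p) y \<longleftrightarrow> QuadRes (int p) z"
    using assms unfolding QuadRes_def by (meson cong_sym cong_trans)
  ultimately show ?thesis
    by (simp add: qres_def)
qed

text \<open>In Euler's criterion the exponent (p - 1)/2 is odd, because p = 7 modulo 8.\<close>

lemma not_qres_minus_1: "\<not> qres (- 1)"
proof -
  have "odd ((p - 1) div 2)"
    using p_mod_8 by presburger
  then have "[Legendre (-1) p = -1] (mod p)"
    using euler_criterion[OF prime, of "-1"] p_ge_7 by simp
  then have "Legendre (-1) p = -1"
    by (rule Legendre_eqI[rotated]) (use p_ge_7 Legendre_in in auto)
  then show ?thesis
    by (simp add: qres_iff_Legendre)
qed

lemma not_p_dvd_1: "\<not> int p dvd 1" "\<not> int p dvd - 1" "\<not> int p dvd 2"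
  using p_ge_7 zdvd_imp_le[of "int p" 2] by auto

lemma qres_minus:
  assumes "\<not> int p dvd z"
  shows "qres (- z) \<longleftrightarrow> \<not> qres z"
  using qres_mult[of "-1" z] not_qres_minus_1 not_p_dvd_1 assms by auto

text \<open>Gauss's lemma: the parity of the number of x \<le> (p - 1)/2 with 2x > (p - 1)/2
  decides, and this number is even.\<close>

lemma qres_2: "qres 2"
proof -
  interpret GAUSS p 2
    using prime p_ge_7 not_p_dvd_1 by unfold_locales (auto simp: cong_0_iff)
  define k where "k = p div 8"
  have p: "p = 8 * k + 7"
    using p_mod_8 unfolding k_def by (metis mult_div_mod_eq)
  \<comment> \<open>The doubles are at most p - 1, hence already reduced. Those above (p - 1)/2 = 4k
    + 3 come from the 2k + 2 values x = 2k + 2, ..., 4k + 3.\<close>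
  have "C = B"
    unfolding C_def B_def A_def image_image by (intro image_cong) auto
  then have "E = (\<lambda>x. 2 * x) ` {2 * int k + 2..4 * int k + 3}"
    unfolding E_def B_def A_def using p by (auto simp: image_iff)
  then have "card E = nat (2 * int k + 2)"
    by (simp add: card_image inj_on_def)
  then have "even (card E)"
    by (simp add: nat_add_distrib nat_mult_distrib)
  then have "Legendre 2 p = 1"
    using gauss_lemma by simp
  then show ?thesis
    by (simp add: qres_iff_Legendre)
qed

end

section \<open>Binary polynomials modulo \<open>x^p - 1\<close>\<close>

text \<open>By default the simplifier rewrites addition and multiplication of bits to \<open>XOR\<close> and \<open>AND\<close>,
  which defeats the ring lemmas.\<close>

declare add_bit_eq_xor [simp del] mult_bit_eq_and [simp del]

lemma bit_add_self: "x + x = (0 :: bit)"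
  by (cases x) simp_all

lemma bit_poly_add_self: "f + f = (0 :: bit poly)"
  by (intro poly_eqI) (simp only: coeff_add coeff_0 bit_add_self)

lemma bit_poly_minus: "- f = (f :: bit poly)"
  by (simp add: poly_eq_iff)

lemma of_nat_bit: "(of_nat n :: bit) = of_bool (odd n)"
  by (induction n) auto

lemma coeff_set_poly:
  assumes "finite S"
  shows "Polynomial.coeff (set_poly S) n = of_bool (n \<in> S)"
  using assms by (simp add: set_poly_def coeff_sum)

lemma poly_set_poly_1: "poly (set_poly S) 1 = of_nat (card S)"
  by (simp add: set_poly_def poly_sum poly_monom)

abbreviation cyclic_modulus :: "nat \<Rightarrow> bit poly" where
  "cyclic_modulus p \<equiv> Polynomial.monom 1 p - 1"

lemma degree_cyclic_modulus:
  assumes "p > 0"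
  shows "degree (cyclic_modulus p) = p"
proof (rule antisym)
  show "degree (cyclic_modulus p) \<le> p"
    by (intro degree_diff_le) (simp_all add: degree_monom_eq)
  show "p \<le> degree (cyclic_modulus p)"
    using assms by (intro le_degree) simp
qed

lemma degree_mod_cyclic_modulus:
  assumes "p > 0"
  shows "degree (f mod cyclic_modulus p) < p"
proof (cases "f mod cyclic_modulus p = 0")
  case False
  moreover have "cyclic_modulus p \<noteq> 0"
    using degree_cyclic_modulus[OF assms] assms by force
  ultimately show ?thesis
    using degree_mod_less'[of "cyclic_modulus p" f] degree_cyclic_modulus[OF assms] by simp
qed (use assms in simp)

lemma mod_cyclic_modulus_eqI:
  assumes "[f = g] (mod cyclic_modulus p)" "\<And>i. Polynomial.coeff g i \<noteq> 0 \<Longrightarrow> i < p" "p > 0"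
  shows "f mod cyclic_modulus p = g"
proof -
  have "degree g < p"
    using assms(2,3) by (cases "g = 0") (auto intro: assms(2))
  then have "g mod cyclic_modulus p = g"
    using degree_cyclic_modulus[OF \<open>p > 0\<close>] by (intro mod_poly_less) simp
  then show ?thesis
    using assms(1) by (simp add: cong_def)
qed

lemma cong_monom_mod:
  "[Polynomial.monom 1 n = Polynomial.monom 1 (n mod p)] (mod cyclic_modulus p)"
proof -
  have "[Polynomial.monom 1 p = 1] (mod cyclic_modulus p)"
    by (simp add: cong_iff_dvd_diff)
  then have "[Polynomial.monom 1 p ^ (n div p) * Polynomial.monom 1 (n mod p) =
      1 ^ (n div p) * Polynomial.monom 1 (n mod p)] (mod cyclic_modulus p)"
    by (intro cong_mult cong_pow cong_refl)
  then show ?thesis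
    by (simp add: monom_power mult_monom)
qed

text \<open>Over F_2 a remainder is the sum of the monomials in its support. This lets arbitrary
  polynomials replace the sets in the description of the codes.\<close>

lemma set_poly_cong_exists:
  assumes "p > 0"
  obtains S where "S \<subseteq> {..<p}" "[set_poly S = f] (mod cyclic_modulus p)"
proof
  define g where "g = f mod cyclic_modulus p"
  let ?S = "{i. i < p \<and> Polynomial.coeff g i = 1}"
  have "set_poly ?S = g"
  proof (rule poly_eqI)
    fix i
    show "Polynomial.coeff (set_poly ?S) i = Polynomial.coeff g i"
      using degree_mod_cyclic_modulus[OF assms, of f] coeff_eq_0[of g i]
      by (cases "Polynomial.coeff g i"; cases "i < p") (auto simp: coeff_set_poly g_def)
  qed
  then show "[set_poly ?S = f] (mod cyclic_modulus p)"
    by (simp add: g_def)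
qed auto

text \<open>Convolution: the term x^b * x^a contributes to position i exactly when b = i - a modulo
  p.\<close>

lemma coeff_cyclic_mult_set_poly:
  assumes "T \<subseteq> {..<p}" "S \<subseteq> {..<p}" "i < p"
  shows "Polynomial.coeff (cyclic_mult p (set_poly T) (set_poly S)) i =
    (\<Sum>a\<in>S. of_bool (nat ((int i - int a) mod int p) \<in> T))"
proof -
  have fin: "finite S" "finite T"
    using assms finite_subset by auto
  \<comment> \<open>The product with every exponent reduced modulo p, which turns out to be the
    remainder itself.\<close>
  define g :: "bit poly" where "g = (\<Sum>a\<in>S. \<Sum>b\<in>T. Polynomial.monom 1 ((b + a) mod p))"
  have "set_poly T * set_poly S = (\<Sum>a\<in>S. \<Sum>b\<in>T. Polynomial.monom 1 (b + a))"
    unfolding set_poly_def sum_product mult_monom by (subst sum.swap) simp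
  then have "[set_poly T * set_poly S = g] (mod cyclic_modulus p)"
    unfolding g_def by (simp only:) (intro cong_sum cong_monom_mod)
  moreover have "j < p" if "Polynomial.coeff g j \<noteq> 0" for j
  proof (rule ccontr)
    assume "\<not> j < p"
    then have "(b + a) mod p \<noteq> j" for a b
      using \<open>i < p\<close> by (metis mod_less_divisor gr_implies_not0 neq0_conv)
    then have "Polynomial.coeff g j = 0"
      by (simp add: g_def coeff_sum)
    then show False
      using that by simp
  qed
  ultimately have "cyclic_mult p (set_poly T) (set_poly S) = g"
    using assms(3) unfolding cyclic_mult_def by (intro mod_cyclic_modulus_eqI) auto
  moreover have "(\<Sum>b\<in>T. of_bool ((b + a) mod p = i)) = (of_bool (nat ((int i - int a) mod int p) \<in> T) :: bit)"
    if "a \<in> S" for a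
  proof -
    have *: "(b + a) mod p = i \<longleftrightarrow> b = nat ((int i - int a) mod int p)" if "b \<in> T" for b
    proof -
      have bp: "b < p"
        using that assms by auto
      have "(b + a) mod p = i \<longleftrightarrow> (int b + int a) mod int p = int i"
        by (metis of_nat_add of_nat_eq_iff of_nat_mod)
      also have "\<dots> \<longleftrightarrow> [int b + int a = int i] (mod int p)"
        using assms(3) by (simp add: cong_def)
      also have "\<dots> \<longleftrightarrow> [int b = int i - int a] (mod int p)"
        by (simp add: cong_iff_dvd_diff algebra_simps)
      also have "\<dots> \<longleftrightarrow> int b = (int i - int a) mod int p"
        using bp by (simp add: cong_def)
      also have "\<dots> \<longleftrightarrow> b = nat ((int i - int a) mod int p)"
        using assms(3) by (auto simp: nat_eq_iff)
      finally show ?thesis .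
    qed
    have "(\<Sum>b\<in>T. of_bool ((b + a) mod p = i)) = (\<Sum>b\<in>T. of_bool (b = nat ((int i - int a) mod int p)) :: bit)"
      by (intro sum.cong) (simp_all add: *)
    also have "\<dots> = of_bool (nat ((int i - int a) mod int p) \<in> T)"
      using fin by (simp add: of_bool_def)
    finally show ?thesis .
  qed
  ultimately show ?thesis
    by (simp add: g_def coeff_sum of_bool_def)
qed

lemma hamming_weight_vec: "hamming_weight (vec n f) = (\<Sum>i<n. of_bool (f i = 1))"
proof -
  have "{i. i < n \<and> vec n f $ i \<noteq> 0} = {i \<in> {..<n}. f i = 1}"
    by auto
  then show ?thesis
    by (simp add: hamming_weight_def sum_of_bool_eq Int_def)
qed

lemma hamming_weight_append:
  "hamming_weight (u @\<^sub>v v) = hamming_weight u + hamming_weight v"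
proof -
  let ?X = "{i. i < dim_vec u \<and> u $ i \<noteq> 0}" and ?Y = "{i. i < dim_vec v \<and> v $ i \<noteq> 0}"
  have "{i. i < dim_vec (u @\<^sub>v v) \<and> (u @\<^sub>v v) $ i \<noteq> 0} = ?X \<union> (\<lambda>i. dim_vec u + i) ` ?Y" (is "?L = ?R")
  proof (rule Set.set_eqI, rule iffI)
    fix i assume i: "i \<in> ?L"
    show "i \<in> ?R"
    proof (cases "i < dim_vec u")
      case False
      then have "i = dim_vec u + (i - dim_vec u)" "i - dim_vec u \<in> ?Y"
        using i by auto
      then show ?thesis
        by blast
    qed (use i in auto)
  qed auto
  moreover have "card (?X \<union> (\<lambda>i. dim_vec u + i) ` ?Y) = card ?X + card ((\<lambda>i. dim_vec u + i) ` ?Y)"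
    by (intro card_Un_disjoint) auto
  ultimately show ?thesis
    by (simp add: hamming_weight_def card_image)
qed

text \<open>Evaluation at 1 sums the coefficients, and it is unaffected by reduction because x^p - 1
  vanishes at 1.\<close>

lemma odd_hamming_weight_iff:
  assumes "p > 0"
  shows "odd (hamming_weight (coeff_vec p (f mod cyclic_modulus p))) \<longleftrightarrow> poly f 1 = 1"
proof -
  define g where "g = f mod cyclic_modulus p"
  have deg: "degree g < p"
    unfolding g_def by (rule degree_mod_cyclic_modulus[OF assms])
  have "(of_nat (hamming_weight (coeff_vec p g)) :: bit) = (\<Sum>i<p. of_bool (Polynomial.coeff g i = 1))"
    by (simp add: coeff_vec_def hamming_weight_vec of_nat_sum del: sum_of_bool_eq)
  also have "\<dots> = (\<Sum>i<p. Polynomial.coeff g i)"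
    by (intro sum.cong) (auto simp: of_bool_def)
  also have "\<dots> = (\<Sum>i\<le>degree g. Polynomial.coeff g i)"
    using deg by (intro sum.mono_neutral_right) (auto simp: coeff_eq_0)
  also have "\<dots> = poly g 1"
    unfolding poly_altdef by (intro sum.cong) (auto simp: power_one)
  also have "\<dots> = poly (f div cyclic_modulus p * cyclic_modulus p + g) 1"
    by (simp add: poly_monom)
  also have "\<dots> = poly f 1"
    by (simp only: g_def div_mult_mod_eq)
  finally show ?thesis
    by (cases "poly f 1") (simp_all add: of_nat_bit g_def)
qed

section \<open>The residue idempotents\<close>

context qr_prime
begin

abbreviation "\<Q> \<equiv> quad_residues p"
abbreviation "\<N> \<equiv> quad_nonresidues p"
abbreviation "rQ \<equiv> set_poly \<Q>"
abbreviation "rN \<equiv> set_poly \<N>"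
abbreviation "J \<equiv> set_poly {..<p}"
abbreviation "M \<equiv> cyclic_modulus p"

lemma int_p_dvd_iff: "a < p \<Longrightarrow> int p dvd int a \<longleftrightarrow> a = 0"
  using nat_dvd_not_less[of a p] by (auto simp: int_dvd_int_iff)

lemma quad_residues_eq: "\<Q> = {a \<in> {..<p}. qres (int a)}"
  unfolding quad_residues_def qres_def using int_p_dvd_iff by auto

lemma QuadRes_0: "QuadRes m 0"
  unfolding QuadRes_def by (rule exI[of _ 0]) simp

text \<open>As -1 is a nonresidue, negation exchanges residues and nonresidues; 0 drops out on the
  left as a square and on the right as a multiple of p.\<close>

lemma quad_nonresidues_eq: "\<N> = {a \<in> {..<p}. qres (- int a)}"
proof -
  have "\<not> QuadRes (int p) (int a) \<longleftrightarrow> qres (- int a)" if "a < p" for a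
  proof (cases "a = 0")
    case True
    then show ?thesis
      using QuadRes_0 by (simp add: qres_def)
  next
    case False
    then show ?thesis
      using qres_minus[of "int a"] int_p_dvd_iff[OF that] by (simp add: qres_def)
  qed
  then show ?thesis
    unfolding quad_nonresidues_def by auto
qed

lemma residues_subset: "\<Q> \<subseteq> {..<p}" "\<N> \<subseteq> {..<p}"
  by (auto simp: quad_residues_def quad_nonresidues_def)

lemma finite_residues: "finite \<Q>" "finite \<N>"
  using residues_subset finite_subset by blast+

lemma residues_partition: "{..<p} = {0} \<union> \<Q> \<union> \<N>" "0 \<notin> \<Q> \<union> \<N>" "\<Q> \<inter> \<N> = {}"
  using p_ge_7 QuadRes_0[of "int p"] by (auto simp: quad_residues_def quad_nonresidues_def)

text \<open>The map a -> p - a exchanges the two sets, because -1 is a nonresidue.\<close>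

lemma card_nonresidues: "card \<N> = card \<Q>"
proof -
  have mem: "p - a \<in> \<N> \<longleftrightarrow> a \<in> \<Q>" if "0 < a" "a < p" for a
  proof -
    have "[- int (p - a) = int a] (mod int p)"
      using that by (simp add: cong_iff_dvd_diff of_nat_diff)
    from qres_cong[OF this] show ?thesis
      using that by (auto simp: quad_residues_eq quad_nonresidues_eq)
  qed
  have pos: "0 < a \<and> a < p" if "a \<in> \<Q> \<union> \<N>" for a
    using that residues_partition residues_subset by (metis Un_iff gr0I lessThan_iff subsetD)
  have "bij_betw (\<lambda>a. p - a) \<Q> \<N>"
  proof (rule bij_betw_byWitness[where f' = "\<lambda>a. p - a"])
    show "(\<lambda>a. p - a) ` \<Q> \<subseteq> \<N>"
      using mem pos by auto
    have "p - a \<in> \<Q>" if "a \<in> \<N>" for a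
      using mem[of "p - a"] pos[of a] that by simp
    then show "(\<lambda>a. p - a) ` \<N> \<subseteq> \<Q>"
      by auto
  qed (use pos in force)+
  then show ?thesis
    using bij_betw_same_card by metis
qed

lemma card_residues: "p = 1 + 2 * card \<Q>"
proof -
  have "card {..<p} = card {0::nat} + card (\<Q> \<union> \<N>)"
    using residues_partition finite_residues
    by (subst residues_partition(1), subst Un_assoc, subst card_Un_disjoint) auto
  also have "card (\<Q> \<union> \<N>) = card \<Q> + card \<N>"
    using residues_partition finite_residues by (intro card_Un_disjoint) auto
  finally show ?thesis
    by (simp add: card_nonresidues)
qed

lemma odd_card_residues: "odd (card \<Q>)"
  using card_residues p_mod_8 by presburger

lemma poly_residues_1: "poly rQ 1 = 1" "poly rN 1 = 1" "poly J 1 = 1"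
proof -
  have "odd p"
    using p_mod_8 by presburger
  then show "poly rQ 1 = 1" "poly rN 1 = 1" "poly J 1 = 1"
    using odd_card_residues by (simp_all add: poly_set_poly_1 of_nat_bit card_nonresidues)
qed

lemma residues_sum: "rN = J - 1 - rQ"
proof -
  have "J = set_poly ({0} \<union> (\<Q> \<union> \<N>))"
    using residues_partition(1) by (simp add: Un_assoc)
  also have "\<dots> = 1 + (rQ + rN)"
    unfolding set_poly_def using residues_partition(2,3) finite_residues
    by (subst sum.union_disjoint, simp, simp, simp) (subst sum.union_disjoint, auto)
  finally show ?thesis
    by simp
qed

text \<open>By the factor theorem x - 1 divides f - f(1), and (x - 1) * J = x^p - 1.\<close>

lemma all_ones_mult: "[J * f = [:poly f 1:] * J] (mod M)"
proof -
  have "[:- 1, 1:] dvd f - [:poly f 1:]"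
    using poly_eq_0_iff_dvd[of "f - [:poly f 1:]" 1] by simp
  then obtain g where g: "f - [:poly f 1:] = [:- 1, 1:] * g"
    by (elim dvdE)
  have "M = [:- 1, 1:] * J"
  proof -
    have "M = [:0, 1:] ^ p - 1"
      by (simp add: monom_altdef)
    also have "\<dots> = ([:0, 1:] - 1) * (\<Sum>i<p. [:0, 1:] ^ i)"
      by (rule power_diff_1_eq)
    also have "[:0, 1:] - 1 = ([:- 1, 1:] :: bit poly)"
      by (simp add: one_pCons)
    finally show ?thesis
      by (simp add: set_poly_def monom_altdef)
  qed
  then have "J * (f - [:poly f 1:]) = M * g"
    by (simp only: g mult_ac)
  then have "J * f - [:poly f 1:] * J = M * g"
    by (simp only: right_diff_distrib mult.commute[of J "[:poly f 1:]"])
  then show ?thesis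
    by (simp add: cong_iff_dvd_diff)
qed

text \<open>Squaring acts on exponents by doubling, which permutes the residues because \<open>2\<close> is one.\<close>

lemma residues_idempotent: "[rQ * rQ = rQ] (mod M)"
proof -
  have sq: "set_poly S ^ 2 = (\<Sum>a\<in>S. Polynomial.monom 1 (2 * a))" if "finite S" for S
    using that
  proof (induction S rule: finite_induct)
    case (insert a S)
    have "set_poly (insert a S) = Polynomial.monom 1 a + set_poly S"
      using insert by (simp add: set_poly_def)
    \<comment> \<open>The mixed term occurs twice and vanishes in characteristic 2, so squaring is
      additive.\<close>
    then have "set_poly (insert a S) ^ 2 = Polynomial.monom 1 (2 * a) + set_poly S ^ 2
        + (Polynomial.monom 1 a * set_poly S + Polynomial.monom 1 a * set_poly S)"
      by (simp add: power2_eq_square algebra_simps mult_monom flip: mult_2)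
    then show ?case
      using insert by (simp only: bit_poly_add_self) simp
  qed (simp add: set_poly_def)
  have "bij_betw (\<lambda>a. 2 * a mod p) \<Q> \<Q>"
  proof -
    have "inj_on (\<lambda>a. 2 * a mod p) \<Q>"
    proof
      fix a b assume ab: "a \<in> \<Q>" "b \<in> \<Q>" "2 * a mod p = 2 * b mod p"
      have "coprime 2 p"
        using p_mod_8 by (subst coprime_left_2_iff_odd) presburger
      then have "[a = b] (mod p)"
        using ab(3) cong_mult_lcancel_nat[of 2 p a b] by (simp add: cong_def)
      then show "a = b"
        using ab(1,2) residues_subset(1) unfolding cong_def by (metis lessThan_iff mod_less subsetD)
    qed
    moreover have "2 * a mod p \<in> \<Q>" if "a \<in> \<Q>" for a
    proof -
      have "[int (2 * a mod p) = 2 * int a] (mod int p)"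
        by (simp add: cong_def zmod_int)
      moreover have "qres (2 * int a)"
        using that qres_2 not_p_dvd_1 by (subst qres_mult) (auto simp: quad_residues_eq qres_def)
      ultimately show ?thesis
        using qres_cong p_ge_7 by (auto simp: quad_residues_eq)
    qed
    ultimately show ?thesis
      using finite_residues endo_inj_surj[of \<Q> "\<lambda>a. 2 * a mod p"] unfolding bij_betw_def by blast
  qed
  then have rQ: "rQ = (\<Sum>a\<in>\<Q>. Polynomial.monom 1 (2 * a mod p))"
    unfolding set_poly_def by (rule sum.reindex_bij_betw[symmetric])
  have "[(\<Sum>a\<in>\<Q>. Polynomial.monom 1 (2 * a)) =
      (\<Sum>a\<in>\<Q>. Polynomial.monom (1::bit) (2 * a mod p))] (mod M)"
    by (intro cong_sum cong_monom_mod)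
  then show ?thesis
    using sq[OF finite_residues(1)] rQ by (simp add: power2_eq_square)
qed

text \<open>With \<open>rN = J - 1 - rQ\<close>, idempotence and rQ(1) = 1 turn the product into
  \<open>J - rQ - rQ\<close>, where the two copies of \<open>rQ\<close> cancel over F_2.\<close>

lemma residues_orthogonal: "[rQ * rN = J] (mod M)"
proof -
  have "[rQ * rN = J - rQ - rQ] (mod M)"
    unfolding residues_sum
    using cong_diff[OF cong_diff[OF all_ones_mult[of rQ] cong_refl[of rQ]] residues_idempotent]
    by (simp add: algebra_simps poly_residues_1)
  also have "J - rQ - rQ = J"
    using bit_poly_add_self[of rQ] by (metis diff_diff_eq diff_0_right)
  finally show ?thesis .
qed

text \<open>Replacing one factor by \<open>J - 1 - rQ\<close> leaves \<open>J - rN - J\<close>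
  modulo x^p - 1, and signs are irrelevant over F_2.\<close>

lemma nonresidues_idempotent: "[rN * rN = rN] (mod M)"
proof -
  have "[J * rN - rN - rQ * rN = J - rN - J] (mod M)"
    using all_ones_mult[of rN] by (intro cong_diff residues_orthogonal cong_refl) (simp add: poly_residues_1)
  moreover have "J * rN - rN - rQ * rN = rN * rN"
    by (simp add: residues_sum algebra_simps)
  moreover have "J - rN - J = rN"
    using bit_poly_minus[of rN] by simp
  ultimately show ?thesis
    by metis
qed

section \<open>The codes as images of multiplication by the idempotents\<close>

definition Q_vec :: "bit poly \<Rightarrow> bit vec" where
  "Q_vec f = coeff_vec p ((rQ * f) mod M)"

definition N_vec :: "bit poly \<Rightarrow> bit vec" where
  "N_vec f = coeff_vec p ((rN * f) mod M)"

text \<open>Codewords depend only on the residue class, so \<open>f\<close> may range over all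
  polynomials and preimages can be built by ring operations.\<close>

lemma vec_cong:
  assumes "[f = g] (mod M)"
  shows "Q_vec f = Q_vec g" "N_vec f = N_vec g"
proof -
  have "[rQ * f = rQ * g] (mod M)" "[rN * f = rN * g] (mod M)"
    by (intro cong_mult cong_refl assms)+
  then show "Q_vec f = Q_vec g" "N_vec f = N_vec g"
    by (simp_all add: Q_vec_def N_vec_def cong_def)
qed

lemma cyclic_set_exists:
  obtains S where "S \<subseteq> {..<p}" "[set_poly S = f] (mod M)"
  using set_poly_cong_exists[of p f] p_ge_7 by auto

lemma qr_code_Q_eq: "qr_code_Q p = range Q_vec"
proof -
  have "qr_code_Q p = {Q_vec (set_poly S) | S. S \<subseteq> {..<p}}"
    by (simp add: qr_code_Q_def Q_vec_def cyclic_mult_def)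
  also have "\<dots> = range Q_vec"
    using vec_cong(1) cyclic_set_exists by (auto simp: image_iff) metis
  finally show ?thesis .
qed

lemma qr_code_N_eq: "qr_code_N p = range N_vec"
proof -
  have "qr_code_N p = {N_vec (set_poly S) | S. S \<subseteq> {..<p}}"
    by (simp add: qr_code_N_def N_vec_def cyclic_mult_def)
  also have "\<dots> = range N_vec"
    using vec_cong(2) cyclic_set_exists by (auto simp: image_iff) metis
  finally show ?thesis .
qed

lemma quasi_qr_code_eq: "quasi_qr_code p = range (\<lambda>f. Q_vec f @\<^sub>v N_vec f)"
proof -
  have "quasi_qr_code p = {Q_vec (set_poly S) @\<^sub>v N_vec (set_poly S) | S. S \<subseteq> {..<p}}"
    by (simp add: quasi_qr_code_def Q_vec_def N_vec_def cyclic_mult_def)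
  also have "\<dots> = range (\<lambda>f. Q_vec f @\<^sub>v N_vec f)"
    using vec_cong cyclic_set_exists by (auto simp: image_iff) metis
  finally show ?thesis .
qed

text \<open>Both idempotents take the value 1 at 1, so multiplying by them preserves the value at 1,
  which is the parity of the weight.\<close>

lemma odd_weight_vec_iff:
  "odd (hamming_weight (Q_vec f)) \<longleftrightarrow> poly f 1 = 1"
  "odd (hamming_weight (N_vec f)) \<longleftrightarrow> poly f 1 = 1"
  using odd_hamming_weight_iff[of p] p_ge_7 by (simp_all add: Q_vec_def N_vec_def poly_residues_1)

text \<open>Up to the all-ones word \<open>J\<close>, the idempotents \<open>rQ\<close> and \<open>rN\<close> are orthogonal, so \<open>rQ * f + rN * g\<close>
  projects to \<open>rQ * f\<close> and \<open>rN * g\<close>; the error terms are removed by a multiple of \<open>J\<close> exactly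
  when \<open>f\<close> and \<open>g\<close> have the same parity.\<close>

lemma common_preimage:
  assumes "poly f 1 = poly g 1"
  obtains s where "Q_vec s = Q_vec f" "N_vec s = N_vec g"
proof -
  define c where "c = [:poly f 1:]"
  define s where "s = rQ * f + rN * g - c * J"
  have "[(rQ * rQ) * f + (rQ * rN) * g - c * (J * rQ) = rQ * f + J * g - c * ([:poly rQ 1:] * J)] (mod M)"
    by (intro cong_add cong_diff cong_mult cong_refl residues_idempotent residues_orthogonal all_ones_mult)
  also have "[rQ * f + J * g - c * ([:poly rQ 1:] * J) = rQ * f + c * J - c * ([:poly rQ 1:] * J)] (mod M)"
    using all_ones_mult[of g] assms by (intro cong_add cong_diff cong_refl) (simp add: c_def)
  finally have "[rQ * s = rQ * f] (mod M)"
    by (simp add: s_def poly_residues_1 algebra_simps)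
  moreover have "[rN * s = rN * g] (mod M)"
  proof -
    have "[(rQ * rN) * f + (rN * rN) * g - c * (J * rN) = J * f + rN * g - c * ([:poly rN 1:] * J)] (mod M)"
      by (intro cong_add cong_diff cong_mult cong_refl nonresidues_idempotent residues_orthogonal all_ones_mult)
    also have "[J * f + rN * g - c * ([:poly rN 1:] * J) = c * J + rN * g - c * ([:poly rN 1:] * J)] (mod M)"
      using all_ones_mult[of f] by (intro cong_add cong_diff cong_refl) (simp add: c_def)
    finally show ?thesis
      by (simp add: s_def poly_residues_1 algebra_simps)
  qed
  ultimately show ?thesis
    by (intro that[of s]) (simp_all add: Q_vec_def N_vec_def cong_def)
qed

text \<open>A concatenated word is even exactly when its components have the same parity, that is
  \<open>poly f 1 = poly g 1\<close>, the condition for a common preimage.\<close>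

theorem quasi_qr_code_even_subcode:
  "quasi_qr_code p = even_subcode (code_direct_sum (qr_code_Q p) (qr_code_N p))"
proof (intro equalityI subsetI)
  fix c assume "c \<in> quasi_qr_code p"
  moreover have "even (hamming_weight (Q_vec f)) \<longleftrightarrow> even (hamming_weight (N_vec f))" for f
    using odd_weight_vec_iff by metis
  ultimately show "c \<in> even_subcode (code_direct_sum (qr_code_Q p) (qr_code_N p))"
    by (auto simp: quasi_qr_code_eq even_subcode_def code_direct_sum_def qr_code_Q_eq qr_code_N_eq
        hamming_weight_append)
next
  fix c assume "c \<in> even_subcode (code_direct_sum (qr_code_Q p) (qr_code_N p))"
  then obtain f g where c: "c = Q_vec f @\<^sub>v N_vec g" and even: "even (hamming_weight c)"
    by (auto simp: even_subcode_def code_direct_sum_def qr_code_Q_eq qr_code_N_eq)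
  have "poly f 1 = 1 \<longleftrightarrow> poly g 1 = 1"
    using even odd_weight_vec_iff(1)[of f] odd_weight_vec_iff(2)[of g]
    by (auto simp: c hamming_weight_append)
  then have "poly f 1 = poly g 1"
    by (metis bit_not_one_iff)
  then obtain s where "Q_vec s = Q_vec f" "N_vec s = N_vec g"
    by (rule common_preimage)
  then show "c \<in> quasi_qr_code p"
    by (auto simp: quasi_qr_code_eq c image_iff intro!: exI[of _ s])
qed

end

section \<open>The Gleason--Prange symmetry\<close>

lemma of_nat_sum_of_bool_bit:
  "(of_nat (\<Sum>y\<in>A. of_bool (f y = 1)) :: bit) = sum f A"
proof -
  have "of_bool (x = 1) = x" for x :: bit
    by (cases x) simp_all
  then show ?thesis
    by (simp add: of_nat_sum del: sum_of_bool_eq)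
qed

lemma sum_mod_shift:
  fixes p k :: int
  assumes "p > 0"
  shows "(\<Sum>a\<in>{0..<p}. f ((a + k) mod p)) = sum f {0..<p}"
proof (rule sum.reindex_bij_betw, rule bij_betw_byWitness[where f' = "\<lambda>a. (a - k) mod p"])
qed (use assms in \<open>auto simp: mod_simps\<close>)

lemma sum_mod_minus:
  fixes p :: int
  assumes "p > 0"
  shows "(\<Sum>a\<in>{0..<p}. f (- a mod p)) = sum f {0..<p}"
proof (rule sum.reindex_bij_betw, rule bij_betw_byWitness[where f' = "\<lambda>a. - a mod p"])
qed (use assms in \<open>auto simp: mod_simps\<close>)

section \<open>Codewords as functions of an integer coordinate\<close>

context qr_prime
begin

text \<open>The coefficient at y of \<open>rQ\<close> times the polynomial with coefficients
  \<open>h\<close>, modulo x^p - 1. An integer argument allows coordinates to be translated and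
  negated directly.\<close>

definition word :: "(int \<Rightarrow> bit) \<Rightarrow> int \<Rightarrow> bit" where
  "word h y = (\<Sum>a\<in>{0..<int p}. h a * of_bool (qres (y - a)))"

definition weight :: "(int \<Rightarrow> bit) \<Rightarrow> nat" where
  "weight f = (\<Sum>y\<in>{0..<int p}. of_bool (f y = 1))"

definition total :: "(int \<Rightarrow> bit) \<Rightarrow> bit" where
  "total h = (\<Sum>a\<in>{0..<int p}. h a)"

lemma pos_int_p: "int p > 0"
  using p_ge_7 by simp

lemma of_bool_qres_cong:
  "[y = z] (mod int p) \<Longrightarrow> (of_bool (qres y) :: bit) = of_bool (qres z)"
  using qres_cong by simp

lemma word_mod: "word h (y mod int p) = word h y"
  unfolding word_def
  by (intro sum.cong arg_cong2[where f = "(*)"] of_bool_qres_cong refl)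
     (simp add: cong_def mod_simps)

lemma word_add: "word (\<lambda>a. h a + k a) y = word h y + word k y"
  by (simp add: word_def sum.distrib distrib_right)

lemma word_sum: "word (\<lambda>a. \<Sum>b\<in>B. c b * H b a) y = (\<Sum>b\<in>B. c b * word (H b) y)"
  unfolding word_def sum_distrib_left sum_distrib_right by (subst sum.swap) (simp add: mult_ac)

lemma word_delta:
  assumes "b \<in> {0..<int p}"
  shows "word (\<lambda>a. of_bool (a = b)) y = of_bool (qres (y - b))"
proof -
  have "word (\<lambda>a. of_bool (a = b)) y = (\<Sum>a\<in>{0..<int p}. if a = b then of_bool (qres (y - a)) else 0)"
    unfolding word_def by (intro sum.cong) auto
  then show ?thesis
    using assms by simp
qed

lemma total_add: "total (\<lambda>a. h a + k a) = total h + total k"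
  by (simp add: total_def sum.distrib)

lemma total_delta: "b \<in> {0..<int p} \<Longrightarrow> total (\<lambda>a. of_bool (a = b)) = 1"
  by (simp add: total_def of_bool_def)

lemma total_const: "total (\<lambda>a. c) = c"
proof -
  have "odd p"
    using p_mod_8 by presburger
  then show ?thesis
    by (simp add: total_def of_nat_bit)
qed

lemma sum_qres: "(\<Sum>y\<in>{0..<int p}. of_bool (qres (y - a))) = (1 :: bit)"
proof -
  have "(\<Sum>y\<in>{0..<int p}. of_bool (qres (y - a)) :: bit) = (\<Sum>y\<in>{0..<int p}. of_bool (qres ((y + (- a)) mod int p)))"
    by (intro sum.cong of_bool_qres_cong) (auto simp: cong_def)
  also have "\<dots> = (\<Sum>y\<in>{0..<int p}. of_bool (qres y))"
    by (rule sum_mod_shift[OF pos_int_p])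
  also have "\<dots> = (\<Sum>y\<in>int ` {..<p}. of_bool (qres y))"
    by (simp add: image_int_atLeastLessThan flip: atLeast0LessThan)
  also have "\<dots> = (\<Sum>y<p. of_bool (y \<in> \<Q>))"
    by (subst sum.reindex) (auto simp: quad_residues_eq intro!: sum.cong)
  also have "\<dots> = of_nat (card \<Q>)"
    using residues_subset by (simp add: Int_absorb1)
  also have "\<dots> = 1"
    using odd_card_residues by (simp add: of_nat_bit)
  finally show ?thesis .
qed

text \<open>Every coordinate counts the residues, an odd number. Hence adding a constant to
  \<open>h\<close> adds the same constant to its word.\<close>

lemma word_const: "word (\<lambda>a. c) y = c"
proof -
  have "word (\<lambda>a. c) y = c * (\<Sum>a\<in>{0..<int p}. of_bool (qres (y - a)))"
    by (simp add: word_def sum_distrib_left)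
  also have "(\<Sum>a\<in>{0..<int p}. of_bool (qres (y - a)) :: bit)
      = (\<Sum>a\<in>{0..<int p}. of_bool (qres ((- a) mod int p + y)))"
    by (intro sum.cong of_bool_qres_cong) (auto simp: cong_def mod_simps)
  also have "\<dots> = (\<Sum>a\<in>{0..<int p}. of_bool (qres (a - (- y))))"
    using sum_mod_minus[OF pos_int_p, of "\<lambda>a. of_bool (qres (a + y)) :: bit"] by simp
  also have "\<dots> = 1"
    by (rule sum_qres)
  finally show ?thesis
    by simp
qed

text \<open>Every translate of the residues has odd size, so summing all coordinates of the word
  returns the sum of \<open>h\<close>.\<close>

lemma total_eq_parity: "total h = of_bool (odd (weight (word h)))"
proof -
  have "of_bool (odd (weight (word h))) = (\<Sum>y\<in>{0..<int p}. word h y)"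
    unfolding weight_def of_nat_bit[symmetric] by (rule of_nat_sum_of_bool_bit)
  also have "\<dots> = (\<Sum>a\<in>{0..<int p}. h a * (\<Sum>y\<in>{0..<int p}. of_bool (qres (y - a))))"
    unfolding word_def sum_distrib_left by (rule sum.swap)
  also have "\<dots> = total h"
    by (simp only: sum_qres total_def mult_1_right)
  finally show ?thesis ..
qed

text \<open>The code is cyclic, because residuosity of y - a depends only on the difference.\<close>

lemma word_shift: "word (\<lambda>a. h ((a + k) mod int p)) y = word h (y + k)"
proof -
  have "word (\<lambda>a. h ((a + k) mod int p)) y
      = (\<Sum>a\<in>{0..<int p}. h ((a + k) mod int p) * of_bool (qres (y + k - (a + k) mod int p)))"
    unfolding word_def
    by (intro sum.cong arg_cong2[where f = "(*)"] of_bool_qres_cong refl)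
       (simp add: cong_def mod_simps)
  also have "\<dots> = word h (y + k)"
    unfolding word_def by (rule sum_mod_shift[OF pos_int_p])
  finally show ?thesis .
qed

lemma weight_shift: "weight (word (\<lambda>a. h ((a + k) mod int p))) = weight (word h)"
proof -
  have "weight (word (\<lambda>a. h ((a + k) mod int p)))
      = (\<Sum>y\<in>{0..<int p}. of_bool (word h ((y + k) mod int p) = 1))"
    by (simp only: weight_def word_shift word_mod)
  also have "\<dots> = weight (word h)"
    unfolding weight_def by (rule sum_mod_shift[OF pos_int_p])
  finally show ?thesis .
qed

section \<open>The map y -> -1/y on nonzero residue classes\<close>

definition neg_inv :: "int \<Rightarrow> int" where
  "neg_inv y = - modular_inverse (int p) y mod int p"

lemma not_dvd_in: "y \<in> {1..<int p} \<Longrightarrow> \<not> int p dvd y"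
  using zdvd_imp_le by fastforce

lemma coprime_in: "y \<in> {1..<int p} \<Longrightarrow> coprime y (int p)"
  using prime_imp_coprime[OF prime_int_p not_dvd_in] by (metis coprime_commute)

lemma neg_inv:
  assumes "y \<in> {1..<int p}"
  shows "neg_inv y \<in> {1..<int p}" "[y * neg_inv y = - 1] (mod int p)"
proof -
  from cong_modular_inverse1[OF coprime_in[OF assms]]
  have "[- (y * modular_inverse (int p) y) = - 1] (mod int p)"
    by (subst cong_minus_minus_iff)
  then show *: "[y * neg_inv y = - 1] (mod int p)"
    by (simp add: neg_inv_def cong_def mod_simps)
  have "neg_inv y \<noteq> 0"
    using * p_ge_7 not_p_dvd_1 by (auto simp: cong_iff_dvd_diff)
  moreover have "neg_inv y \<in> {0..<int p}"
    using pos_int_p by (simp add: neg_inv_def)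
  ultimately show "neg_inv y \<in> {1..<int p}"
    by auto
qed

lemma neg_inv_unique:
  assumes "y \<in> {1..<int p}" "z \<in> {1..<int p}" "[y * z = - 1] (mod int p)"
  shows "z = neg_inv y"
proof -
  have "[y * z = y * neg_inv y] (mod int p)"
    using assms(3) neg_inv(2)[OF assms(1)] by (meson cong_sym cong_trans)
  then have "[z = neg_inv y] (mod int p)"
    by (simp add: cong_mult_lcancel[OF coprime_in[OF assms(1)]])
  then show ?thesis
    using assms(2) neg_inv(1)[OF assms(1)] by (simp add: cong_def)
qed

lemma neg_inv_neg_inv:
  assumes "y \<in> {1..<int p}"
  shows "neg_inv (neg_inv y) = y"
  using neg_inv_unique[OF neg_inv(1)[OF assms] assms] neg_inv(2)[OF assms]
  by (simp add: mult.commute)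

text \<open>The product of y and -1/y is the nonresidue -1, so exactly one factor is a
  residue.\<close>

lemma qres_neg_inv:
  assumes "y \<in> {1..<int p}"
  shows "qres (neg_inv y) \<longleftrightarrow> \<not> qres y"
proof -
  have "qres (y * neg_inv y) \<longleftrightarrow> qres (- 1)"
    by (rule qres_cong[OF neg_inv(2)[OF assms]])
  then show ?thesis
    using qres_mult[OF not_dvd_in[OF assms] not_dvd_in[OF neg_inv(1)[OF assms]]] not_qres_minus_1
    by simp
qed

text \<open>Modulo p, y * (-1/y - a) = -a * (y + 1/a), and -1 is a nonresidue. At the excluded point
  y = -1/a both differences vanish.\<close>

lemma qres_neg_inv_diff:
  assumes a: "a \<in> {1..<int p}" and y: "y \<in> {1..<int p}" and ne: "y \<noteq> neg_inv a"
  shows "qres (neg_inv y - a) \<longleftrightarrow> (qres y \<longleftrightarrow> \<not> (qres a \<longleftrightarrow> qres (y - neg_inv a)))"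
proof -
  have y_ne: "\<not> int p dvd y - neg_inv a"
    using y neg_inv(1)[OF a] ne by (auto simp: zdvd_imp_le simp flip: mod_eq_dvd_iff)
  have a_ne: "\<not> int p dvd neg_inv y - a"
  proof
    assume "int p dvd neg_inv y - a"
    then have "neg_inv y = a"
      using a neg_inv(1)[OF y] by (auto simp flip: mod_eq_dvd_iff)
    then show False
      using ne neg_inv_neg_inv[OF y] by simp
  qed
  \<comment> \<open>Explicit multiples of p reduce the congruence to an identity of
    integers.\<close>
  obtain u where u: "y * neg_inv y - (- 1) = int p * u"
    using neg_inv(2)[OF y] by (auto simp: cong_iff_dvd_diff elim: dvdE)
  obtain v where v: "a * neg_inv a - (- 1) = int p * v"
    using neg_inv(2)[OF a] by (auto simp: cong_iff_dvd_diff elim: dvdE)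
  have "y * (neg_inv y - a) - (- (a * (y - neg_inv a))) = (y * neg_inv y - (- 1)) - (a * neg_inv a - (- 1))"
    by (simp add: algebra_simps)
  also have "\<dots> = int p * (u - v)"
    by (simp only: u v right_diff_distrib)
  finally have "y * (neg_inv y - a) - (- (a * (y - neg_inv a))) = int p * (u - v)" .
  then have "[y * (neg_inv y - a) = - (a * (y - neg_inv a))] (mod int p)"
    by (simp only: cong_iff_dvd_diff dvd_triv_left)
  then have "qres (y * (neg_inv y - a)) \<longleftrightarrow> qres (- (a * (y - neg_inv a)))"
    by (rule qres_cong)
  moreover have "\<not> int p dvd a * (y - neg_inv a)"
    using y_ne not_dvd_in[OF a] prime_int_p by (simp add: prime_dvd_mult_iff)
  ultimately show ?thesis
    using qres_mult[OF not_dvd_in[OF y] a_ne] qres_mult[OF not_dvd_in[OF a] y_ne]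
    by (auto simp: qres_minus)
qed

text \<open>The extended code carries an additional coordinate \<open>\<infinity>\<close> with value \<^term>\<open>total h\<close>. The map
  \<open>y \<mapsto> -1/y\<close> of the projective line, which exchanges \<open>0\<close> and \<open>\<infinity>\<close>, preserves it.\<close>

lemma Gleason_Prange_generator:
  assumes a: "a \<in> {0..<int p}"
  shows "\<exists>h. word h 0 = 1 \<and> total h = of_bool (qres (0 - a)) \<and>
    (\<forall>y\<in>{1..<int p}. word h y = of_bool (qres (neg_inv y - a)))"
proof (cases "a = 0")
  case True
  \<comment> \<open>The complement of the generator at 0: for nonzero y, -1/y is a residue exactly
    when y is not.\<close>
  define h :: "int \<Rightarrow> bit" where "h = (\<lambda>x. of_bool (x = 0) + 1)"
  have "word h y = of_bool (qres y) + 1" for y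
    unfolding h_def word_add word_const using word_delta[of 0 y] pos_int_p by simp
  moreover have "total h = 0"
    unfolding h_def total_add total_const using total_delta[of 0] pos_int_p by (simp add: bit_add_self)
  ultimately show ?thesis
    using True qres_neg_inv by (intro exI[of _ h]) (auto simp: not_qres_0 bit_add_self)
next
  case False
  then have a1: "a \<in> {1..<int p}"
    using a by auto
  define j where "j = neg_inv a"
  have j: "j \<in> {1..<int p}"
    unfolding j_def by (rule neg_inv(1)[OF a1])
  \<comment> \<open>The generators at 0 and -1/a together with a multiple of the all-ones word, as
    read off from \<open>qres_neg_inv_diff\<close>; the constant accounts for the factor -a
    there.\<close>
  define h :: "int \<Rightarrow> bit" where
    "h = (\<lambda>x. of_bool (x = 0) + of_bool (x = j) + of_bool (\<not> qres a))"
  have word_h: "word h y = of_bool (qres y) + of_bool (qres (y - j)) + of_bool (\<not> qres a)" for y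
    unfolding h_def word_add word_const using word_delta[of 0 y] word_delta[of j y] j pos_int_p by simp
  have "total h = 0 + of_bool (\<not> qres a)"
    unfolding h_def total_add total_const using total_delta[of 0] total_delta[of j] j pos_int_p
    by (simp add: bit_add_self)
  moreover have "qres (- a) \<longleftrightarrow> \<not> qres a" "qres (- j) \<longleftrightarrow> qres a"
    using qres_minus not_dvd_in[OF a1] not_dvd_in[OF j] qres_neg_inv[OF a1] by (auto simp: j_def)
  moreover have "word h y = of_bool (qres (neg_inv y - a))" if y: "y \<in> {1..<int p}" for y
  proof (cases "y = j")
    case True
    then show ?thesis
      using neg_inv_neg_inv[OF a1] qres_neg_inv[OF a1]
      by (simp add: word_h not_qres_0 j_def bit_add_self)
  next
    case False
    then show ?thesis
      using qres_neg_inv_diff[OF a1 y] by (auto simp: word_h j_def bit_add_self)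
  qed
  ultimately show ?thesis
    by (intro exI[of _ h]) (auto simp: word_h not_qres_0)
qed

text \<open>Linear extension: an image \<open>H a\<close> is chosen for each generator, and these
  are combined with the coefficients \<open>h a\<close>.\<close>

lemma Gleason_Prange:
  obtains h' where "word h' 0 = total h" "total h' = word h 0"
    "\<And>y. y \<in> {1..<int p} \<Longrightarrow> word h' y = word h (neg_inv y)"
proof -
  have "\<exists>H. \<forall>a\<in>{0..<int p}. word (H a) 0 = 1 \<and> total (H a) = of_bool (qres (0 - a)) \<and>
      (\<forall>y\<in>{1..<int p}. word (H a) y = of_bool (qres (neg_inv y - a)))"
    by (intro bchoice ballI Gleason_Prange_generator)
  then obtain H where H_all: "\<forall>a\<in>{0..<int p}. word (H a) 0 = 1 \<and> total (H a) = of_bool (qres (0 - a)) \<and>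
      (\<forall>y\<in>{1..<int p}. word (H a) y = of_bool (qres (neg_inv y - a)))" ..
  note H = H_all[THEN bspec, THEN conjunct1] H_all[THEN bspec, THEN conjunct2, THEN conjunct1]
    H_all[THEN bspec, THEN conjunct2, THEN conjunct2, THEN bspec]
  define h' where "h' = (\<lambda>x. \<Sum>a\<in>{0..<int p}. h a * H a x)"
  have "word h' 0 = total h"
    using H(1) by (simp add: h'_def word_sum total_def)
  moreover have "total h' = word h 0"
  proof -
    have "total h' = (\<Sum>a\<in>{0..<int p}. h a * total (H a))"
      unfolding total_def h'_def sum_distrib_left by (rule sum.swap)
    then show ?thesis
      using H(2) by (simp add: word_def)
  qed
  moreover have "word h' y = word h (neg_inv y)" if "y \<in> {1..<int p}" for y
    using H(3)[OF _ that] by (simp add: h'_def word_sum) (simp add: word_def)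
  ultimately show ?thesis
    by (rule that)
qed

section \<open>Moving a coordinate to infinity\<close>

lemma weight_split: "weight f = of_bool (f 0 = 1) + (\<Sum>y\<in>{1..<int p}. of_bool (f y = 1))"
proof -
  have "{0..<int p} = insert 0 {1..<int p}"
    using pos_int_p by auto
  then show ?thesis
    by (simp add: weight_def del: sum_of_bool_eq)
qed

text \<open>A translation brings coordinate y to 0, and y -> -1/y exchanges it with infinity. The
  extended weight is unchanged, so the word gives up its coordinate y and gains its parity
  bit.\<close>

lemma weight_exchange:
  obtains h' where
    "weight (word h') + of_bool (word h y = 1) = weight (word h) + of_bool (odd (weight (word h)))"
proof -
  define g where "g = (\<lambda>a. h ((a + y) mod int p))"
  obtain h' where h': "word h' 0 = total g" "total h' = word g 0"
      "\<And>y. y \<in> {1..<int p} \<Longrightarrow> word h' y = word g (neg_inv y)"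
    using Gleason_Prange[of g] by metis
  have "bij_betw neg_inv {1..<int p} {1..<int p}"
    by (rule bij_betw_byWitness[where f' = neg_inv]) (auto simp: neg_inv_neg_inv neg_inv simp del: atLeastLessThan_iff)
  then have "(\<Sum>y\<in>{1..<int p}. of_bool (word g (neg_inv y) = 1)) = (\<Sum>y\<in>{1..<int p}. of_bool (word g y = 1) :: nat)"
    by (rule sum.reindex_bij_betw)
  then have "(\<Sum>y\<in>{1..<int p}. of_bool (word h' y = 1)) = (\<Sum>y\<in>{1..<int p}. of_bool (word g y = 1) :: nat)"
    using h'(3) by (simp del: sum_of_bool_eq)
  then have "weight (word h') + of_bool (word g 0 = 1) = weight (word g) + of_bool (total g = 1)"
    using h'(1) by (simp add: weight_split del: sum_of_bool_eq)
  moreover have "word g 0 = word h y" "weight (word g) = weight (word h)"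
    by (simp_all only: g_def word_shift weight_shift add_0)
  moreover have "total g = 1 \<longleftrightarrow> odd (weight (word g))"
    by (simp add: total_eq_parity)
  ultimately show ?thesis
    using that[of h'] by simp
qed

text \<open>The parity bit is 0 here, so exchanging it with a nonzero coordinate costs one.\<close>

lemma weight_pred:
  assumes "even (weight (word h))" "weight (word h) \<noteq> 0"
  obtains h' where "weight (word h') = weight (word h) - 1"
proof -
  have "\<exists>y. word h y = 1"
    using assms(2) by (auto simp: weight_def)
  then obtain y where y: "word h y = 1" ..
  obtain h' where "weight (word h') + of_bool (word h y = 1) = weight (word h) + of_bool (odd (weight (word h)))"
    by (rule weight_exchange)
  then show ?thesis
    using y assms by (intro that[of h']) simp
qed

text \<open>A weight below p leaves a zero coordinate to exchange with the parity bit 1.\<close>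

lemma weight_Suc:
  assumes "odd (weight (word h))" "weight (word h) < p"
  obtains h' where "weight (word h') = weight (word h) + 1"
proof -
  have "\<exists>y. word h y \<noteq> 1"
  proof (rule ccontr)
    assume "\<not> ?thesis"
    then have "weight (word h) = p"
      by (simp add: weight_def)
    with assms show False
      by simp
  qed
  then obtain y where y: "word h y \<noteq> 1" ..
  obtain h' where "weight (word h') + of_bool (word h y = 1) = weight (word h) + of_bool (odd (weight (word h)))"
    by (rule weight_exchange)
  then show ?thesis
    using y assms by (intro that[of h']) simp
qed

text \<open>The word of \<open>rQ\<close> itself: its weight is odd, hence nonzero, and it vanishes
  at 0. It shows that the minimum distance exists and lies below p.\<close>

lemma exists_small_weight:
  obtains h where "weight (word h) \<noteq> 0" "weight (word h) < p"
proof -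
  define h :: "int \<Rightarrow> bit" where "h = (\<lambda>a. of_bool (a = 0))"
  have w: "word h y = of_bool (qres y)" for y
    unfolding h_def using word_delta[of 0 y] pos_int_p by simp
  have "total h = 1"
    unfolding h_def using total_delta[of 0] pos_int_p by simp
  then have "weight (word h) \<noteq> 0"
    by (auto simp: total_eq_parity odd_pos)
  moreover have "weight (word h) < p"
  proof -
    have "weight (word h) = (\<Sum>y\<in>{1..<int p}. of_bool (word h y = 1))"
      by (simp add: weight_split w not_qres_0 del: sum_of_bool_eq)
    also have "\<dots> \<le> (\<Sum>y\<in>{1..<int p}. 1)"
      by (intro sum_mono) simp
    also have "\<dots> < p"
      using p_ge_7 by simp
    finally show ?thesis .
  qed
  ultimately show ?thesis
    by (rule that)
qed

section \<open>The nonresidue code as mirror image of the residue code\<close>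

definition nword :: "(int \<Rightarrow> bit) \<Rightarrow> int \<Rightarrow> bit" where
  "nword h y = (\<Sum>a\<in>{0..<int p}. h a * of_bool (qres (a - y)))"

text \<open>In \<open>nword\<close>, \<open>qres (a - y)\<close> expresses that y - a is a
  nonresidue. Substituting -a for a gives the residue pattern at -y.\<close>

lemma nword_eq: "nword h y = word (\<lambda>a. h (- a mod int p)) (- y)"
proof -
  have "word (\<lambda>a. h (- a mod int p)) (- y)
      = (\<Sum>a\<in>{0..<int p}. h (- a mod int p) * of_bool (qres ((- a mod int p) - y)))"
    unfolding word_def
    by (intro sum.cong arg_cong2[where f = "(*)"] of_bool_qres_cong refl)
       (simp add: cong_def mod_simps minus_diff_commute)
  also have "\<dots> = nword h y"
    unfolding nword_def by (rule sum_mod_minus[OF pos_int_p])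
  finally show ?thesis ..
qed

text \<open>Negation permutes the coordinates, so every weight of the nonresidue code occurs in the
  residue code.\<close>

lemma weight_nword: "weight (nword h) = weight (word (\<lambda>a. h (- a mod int p)))"
proof -
  have "weight (nword h) = (\<Sum>y\<in>{0..<int p}. of_bool (word (\<lambda>a. h (- a mod int p)) (- y mod int p) = 1))"
    by (simp only: weight_def nword_eq word_mod)
  also have "\<dots> = weight (word (\<lambda>a. h (- a mod int p)))"
    unfolding weight_def by (rule sum_mod_minus[OF pos_int_p])
  finally show ?thesis .
qed


section \<open>The minimum distance\<close>

lemma sum_set_indicator:
  assumes "S \<subseteq> {..<p}"
  shows "(\<Sum>a\<in>{0..<int p}. of_bool (a \<in> int ` S) * f a) = (\<Sum>a\<in>S. f (int a) :: bit)"
proof -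
  have "(\<Sum>a\<in>S. f (int a)) = sum f (int ` S)"
    by (simp add: sum.reindex)
  also have "\<dots> = (\<Sum>a\<in>{0..<int p}. of_bool (a \<in> int ` S) * f a)"
    using assms by (intro sum.mono_neutral_cong_left) auto
  finally show ?thesis ..
qed

text \<open>The convolution formula links the polynomial codes to \<open>word\<close> and
  \<open>nword\<close>: i - a lies in the nonresidues exactly when a - i is a residue.\<close>

lemma codeword_vec:
  assumes "S \<subseteq> {..<p}"
  shows "coeff_vec p (cyclic_mult p rQ (set_poly S)) = vec p (\<lambda>i. word (\<lambda>a. of_bool (a \<in> int ` S)) (int i))"
    and "coeff_vec p (cyclic_mult p rN (set_poly S)) = vec p (\<lambda>i. nword (\<lambda>a. of_bool (a \<in> int ` S)) (int i))"
proof -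
  have mod_less: "nat (z mod int p) < p" for z
    using pos_int_p by (simp add: nat_less_iff)
  have "qres (int (nat (z mod int p))) \<longleftrightarrow> qres z" "qres (- int (nat (z mod int p))) \<longleftrightarrow> qres (- z)" for z
    using pos_int_p by (auto intro!: qres_cong simp: cong_def mod_simps)
  then have mem: "nat (z mod int p) \<in> \<Q> \<longleftrightarrow> qres z" "nat (z mod int p) \<in> \<N> \<longleftrightarrow> qres (- z)" for z
    using mod_less by (simp_all add: quad_residues_eq quad_nonresidues_eq)
  show "coeff_vec p (cyclic_mult p rQ (set_poly S)) = vec p (\<lambda>i. word (\<lambda>a. of_bool (a \<in> int ` S)) (int i))"
    unfolding coeff_vec_def word_def sum_set_indicator[OF assms]
    by (intro eq_vecI) (simp_all add: coeff_cyclic_mult_set_poly residues_subset assms mem)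
  show "coeff_vec p (cyclic_mult p rN (set_poly S)) = vec p (\<lambda>i. nword (\<lambda>a. of_bool (a \<in> int ` S)) (int i))"
    unfolding coeff_vec_def nword_def sum_set_indicator[OF assms]
    by (intro eq_vecI) (simp_all add: coeff_cyclic_mult_set_poly residues_subset assms mem)
qed

lemma indicator_exists:
  obtains S where "S \<subseteq> {..<p}" "\<And>a. a \<in> {0..<int p} \<Longrightarrow> of_bool (a \<in> int ` S) = (h a :: bit)"
proof
  let ?S = "{a \<in> {..<p}. h (int a) = 1}"
  show "of_bool (a \<in> int ` ?S) = h a" if "a \<in> {0..<int p}" for a
    using that by (cases "h a") (auto simp: image_iff dest: zero_le_imp_eq_int)
qed auto

lemma qr_code_Q_words: "qr_code_Q p = range (\<lambda>h. vec p (\<lambda>i. word h (int i)))"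
proof (intro equalityI subsetI)
  fix c assume "c \<in> range (\<lambda>h. vec p (\<lambda>i. word h (int i)))"
  then obtain h where c: "c = vec p (\<lambda>i. word h (int i))"
    by blast
  obtain S where S: "S \<subseteq> {..<p}" "\<And>a. a \<in> {0..<int p} \<Longrightarrow> of_bool (a \<in> int ` S) = h a"
    using indicator_exists by blast
  have "word (\<lambda>a. of_bool (a \<in> int ` S)) = word h"
    unfolding word_def using S(2) by (intro ext sum.cong) auto
  then have "c = coeff_vec p (cyclic_mult p rQ (set_poly S))"
    using codeword_vec(1)[OF S(1)] c by (simp only:)
  with S(1) show "c \<in> qr_code_Q p"
    unfolding qr_code_Q_def by (intro CollectI exI[of _ S] conjI)
qed (auto simp: qr_code_Q_def codeword_vec)

lemma qr_code_N_words: "qr_code_N p = range (\<lambda>h. vec p (\<lambda>i. nword h (int i)))"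
proof (intro equalityI subsetI)
  fix c assume "c \<in> range (\<lambda>h. vec p (\<lambda>i. nword h (int i)))"
  then obtain h where c: "c = vec p (\<lambda>i. nword h (int i))"
    by blast
  obtain S where S: "S \<subseteq> {..<p}" "\<And>a. a \<in> {0..<int p} \<Longrightarrow> of_bool (a \<in> int ` S) = h a"
    using indicator_exists by blast
  have "nword (\<lambda>a. of_bool (a \<in> int ` S)) = nword h"
    unfolding nword_def using S(2) by (intro ext sum.cong) auto
  then have "c = coeff_vec p (cyclic_mult p rN (set_poly S))"
    using codeword_vec(2)[OF S(1)] c by (simp only:)
  with S(1) show "c \<in> qr_code_N p"
    unfolding qr_code_N_def by (intro CollectI exI[of _ S] conjI)
qed (auto simp: qr_code_N_def codeword_vec)

lemma hamming_weight_word: "hamming_weight (vec p (\<lambda>i. f (int i))) = weight f"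
proof -
  have "(\<Sum>i<p. of_bool (f (int i) = 1)) = (\<Sum>y\<in>int ` {..<p}. of_bool (f y = 1) :: nat)"
    by (simp add: sum.reindex del: sum_of_bool_eq)
  then show ?thesis
    by (simp add: hamming_weight_vec weight_def image_int_atLeastLessThan del: sum_of_bool_eq
        flip: atLeast0LessThan)
qed

lemma weights_Q: "hamming_weight ` qr_code_Q p = range (\<lambda>h. weight (word h))"
  by (simp add: qr_code_Q_words image_image hamming_weight_word)

lemma weights_N: "hamming_weight ` qr_code_N p \<subseteq> hamming_weight ` qr_code_Q p"
  unfolding weights_Q qr_code_N_words by (auto simp: hamming_weight_word weight_nword)

text \<open>The zero word, which pads a word of the residue code without changing its
  weight.\<close>

lemma nword_0: "vec p (\<lambda>i. nword (\<lambda>a. 0) (int i)) \<in> qr_code_N p"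
    "hamming_weight (vec p (\<lambda>i. nword (\<lambda>a. 0) (int i))) = 0"
  unfolding hamming_weight_word qr_code_N_words by (rule rangeI) (simp add: nword_def weight_def)

lemma finite_weights: "finite (range (\<lambda>h. weight (word h)))"
proof (rule finite_subset)
  show "range (\<lambda>h. weight (word h)) \<subseteq> {..p}"
  proof (rule image_subsetI)
    fix h
    have "weight (word h) \<le> (\<Sum>y\<in>{0..<int p}. 1)"
      unfolding weight_def by (intro sum_mono) simp
    then show "weight (word h) \<in> {..p}"
      by simp
  qed
qed simp

theorem min_distance_quasi_qr_code:
  "min_distance (quasi_qr_code p) = min_distance (qr_code_Q p) + 1"
proof -
  define W where "W = range (\<lambda>h. weight (word h))"
  define d where "d = Min (W - {0})"
  have d: "d = min_distance (qr_code_Q p)"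
    by (simp add: d_def min_distance_def weights_Q W_def)
  have fin: "finite (W - {0})"
    using finite_weights by (simp add: W_def)
  obtain h0 where h0: "weight (word h0) \<noteq> 0" "weight (word h0) < p"
    by (rule exists_small_weight)
  then have "weight (word h0) \<in> W - {0}"
    by (simp add: W_def)
  then have "W - {0} \<noteq> {}"
    by blast
  then have "d \<in> W - {0}"
    unfolding d_def by (intro Min_in fin)
  then obtain h where h: "weight (word h) = d" "d \<noteq> 0"
    by (auto simp: W_def)
  have d_le: "d \<le> w" if "w \<in> W" "w \<noteq> 0" for w
    using that fin by (simp add: d_def)
  have "odd d"
  proof
    assume "even d"
    then obtain h' where "weight (word h') = d - 1"
      using weight_pred[of h] h by metis
    then have "d - 1 \<in> W"
      unfolding W_def by (metis rangeI)
    \<comment> \<open>An even nonzero \<open>d\<close> is at least 2, so \<open>d - 1\<close> would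
      be a smaller nonzero weight.\<close>
    moreover have "d - 1 \<noteq> 0"
      using \<open>even d\<close> h(2) by (cases "d = 1") auto
    ultimately show False
      using d_le[of "d - 1"] h(2) by simp
  qed
  \<comment> \<open>This guarantees a zero coordinate in a word of minimum weight, as
    \<open>weight_Suc\<close> requires.\<close>
  have "d < p"
    using d_le[of "weight (word h0)"] h0 by (auto simp: W_def)
  then obtain h' where h': "weight (word h') = d + 1"
    using weight_Suc[of h] h \<open>odd d\<close> by metis
  have "Min (hamming_weight ` quasi_qr_code p - {0}) = d + 1"
  proof (rule Min_eqI)
    let ?u = "vec p (\<lambda>i. word h' (int i))" and ?v = "vec p (\<lambda>i. nword (\<lambda>a. 0) (int i))"
    have w: "hamming_weight (?u @\<^sub>v ?v) = d + 1"
      by (simp only: hamming_weight_append nword_0(2) hamming_weight_word h')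
    moreover have "?u \<in> qr_code_Q p"
      by (auto simp: qr_code_Q_words)
    ultimately have "?u @\<^sub>v ?v \<in> quasi_qr_code p"
      unfolding quasi_qr_code_even_subcode even_subcode_def code_direct_sum_def
      using nword_0(1) \<open>odd d\<close> by auto
    then show "d + 1 \<in> hamming_weight ` quasi_qr_code p - {0}"
      using w by (metis DiffI Suc_eq_plus1 image_eqI nat.distinct(1) singletonD)
  next
    fix w assume w: "w \<in> hamming_weight ` quasi_qr_code p - {0}"
    then obtain u v where uv: "u \<in> qr_code_Q p" "v \<in> qr_code_N p" "w = hamming_weight u + hamming_weight v"
        "even w" "w \<noteq> 0"
      unfolding quasi_qr_code_even_subcode even_subcode_def code_direct_sum_def
      by (auto simp: hamming_weight_append)
    have "hamming_weight u \<in> W" "hamming_weight v \<in> W"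
      using uv weights_N unfolding W_def weights_Q[symmetric] by auto
    then have "d \<le> w"
      using d_le[of "hamming_weight u"] d_le[of "hamming_weight v"] uv(3,5) by auto
    \<comment> \<open>Since \<open>w\<close> is even and \<open>d\<close> is odd, they cannot be
      equal.\<close>
    then show "d + 1 \<le> w"
      using \<open>odd d\<close> \<open>even w\<close> by (cases "d = w") auto
  next
    \<comment> \<open>\<open>Min\<close> needs finiteness: every weight here is a sum of two of the
      finitely many weights of the residue code.\<close>
    have "hamming_weight ` quasi_qr_code p \<subseteq> (\<lambda>(a, b). a + b) ` (W \<times> W)"
      unfolding quasi_qr_code_even_subcode even_subcode_def code_direct_sum_def
      using weights_N unfolding W_def weights_Q[symmetric]
      by (force simp: hamming_weight_append)
    then show "finite (hamming_weight ` quasi_qr_code p - {0})"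
      using finite_weights by (metis W_def finite_Diff finite_SigmaI finite_imageI finite_subset)
  qed
  then show ?thesis
    unfolding d min_distance_def[of "quasi_qr_code p"] .
qed

end

theorem proposition2p5:
  fixes p :: nat
  assumes "prime p" and "[p = 7] (mod 8)"
  shows "quasi_qr_code p = even_subcode (code_direct_sum (qr_code_Q p) (qr_code_N p)) \<and>
         min_distance (quasi_qr_code p) = min_distance (qr_code_Q p) + 1"
proof -
  interpret qr_prime p
    by (rule qr_prime.intro[OF assms])
  show ?thesis
    using quasi_qr_code_even_subcode min_distance_quasi_qr_code by simp
qed

end
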